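(* Let $k,N$ be integers with $1\le k\le N-1$. The map $\Phi:L_{\mathsf A}^{\mathrm{part}}(k,N-k)\to D_{\mathsf A}^{\mathrm{part}}(k,N-k)$ defined as follows is an edge-color preserving isomorphism of directed graphs. For $\sigma=(\sigma_1,\dots,\sigma_k)$, let $T(\sigma)=\{N-k+r-\sigma_r : 1\le r\le k\}\subseteq\{1,\dots,N\}$, list the $k$-element set $\pi(T(\sigma))$ in decreasing order as $S_1>S_2>\cdots>S_k$, and set $$\Phi(\sigma)=(S_j-k+j-1)_{j=1}^k .$$ Its inverse $\Phi^{-1}:D_{\mathsf A}^{\mathrm{part}}(k,N-k)\to L_{\mathsf A}^{\mathrm{part}}(k,N-k)$ is given as follows: for $\tau=(\tau_1,\dots,\tau_k)$, let $S(\tau)=\{\tau_j+k-j+1:1\le j\le k\}$, list $\pi^{-1}(S(\tau))$ in increasing order as $T_1<T_2<\cdots<T_k$, and set $\Phi^{-1}(\tau)=(N-k+r-T_r)_{r=1}^k$.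
   Context: A $k\times(N-k)$ partition is an integer sequence $\sigma=(\sigma_1,\dots,\sigma_k)$ with $N-k\ge\sigma_1\ge\cdots\ge\sigma_k\ge0$. Both $L_{\mathsf A}^{\mathrm{part}}(k,N-k)$ and $D_{\mathsf A}^{\mathrm{part}}(k,N-k)$ are directed graphs whose vertex set is the set of all $k\times(N-k)$ partitions and whose edges are colored by $\{1,\dots,N-1\}$. Permutation $\pi$ of $\{1,\dots,N\}$: if $N$ is even, $\pi(i)=2i-1$ for $1\le i\le N/2$ and $\pi(j)=2N-2(j-1)$ for $N/2+1\le j\le N$; if $N$ is odd, $\pi(i)=2i$ for $1\le i\le\lfloor N/2\rfloor$ and $\pi(j)=2(N-j)+1$ for $\lceil N/2\rceil\le j\le N$. $L_{\mathsf A}^{\mathrm{part}}(k,N-k)$ (type $\mathsf A$ fundamental lattice): there is a directed edge $\sigma\to\tau$ iff $\tau-\sigma=\varepsilon_l$ for some $1\le l\le k$ ($\varepsilon_l$ the $l$th standard basis vector); this edge has color $i=N-k-\tau_l+l$. $D_{\mathsf A}^{\mathrm{part}}(k,N-k)$ (Domino Game digraph): identify $\sigma$ with the left-justified shape having $\sigma_r$ boxes in row $r$ of a board with $k$ rows (numbered from top) and $N-k$ columns (numbered from left). Square $(r,c)$ of the board is red iff $r+c\equiv 1+N-k\pmod 2$ (so the upper right square is red) and white otherwise. There is a directed edge $\sigma\to\tau$ iff $\tau$ is obtained from $\sigma$ by one of the following moves: (i) removing from $\sigma$ either a horizontal domino (two horizontally adjacent squares) with left square red and right square white, or a vertical domino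 (two vertically adjacent squares) with top square white and bottom square red, or the single square in the upper right corner $(1,N-k)$; (ii) adding to $\sigma$ either a horizontal domino with left square white and right square red, or a vertical domino with top square red and bottom square white. Colors in $D_{\mathsf A}^{\mathrm{part}}(k,N-k)$: with $S(\sigma)=\{\sigma_j+k-j+1:1\le j\le k\}$, define $(x_i,y_i)$ for $1\le i\le N-1$ as follows. If $N$ is even: $(2i-1,2i+1)$ for $1\le i<N/2$; $(2i-1,2i)$ for $i=N/2$; $(2N-2i+2,2N-2i)$ for $N/2<i\le N-1$. If $N$ is odd: $(2i,2i+2)$ for $1\le i<\lfloor N/2\rfloor$; $(2i,2i+1)$ for $i=\lfloor N/2\rfloor$; $(2N-2i+1,2N-2i-1)$ for $\lceil N/2\rceil\le i\le N-1$. The edge $\sigma\to\tau$ has color $i$ iff $x_i\in S(\tau)$, $y_i\notin S(\tau)$ and $S(\sigma)=(S(\tau)\setminus\{x_i\})\cup\{y_i\}$. An edge-color preserving isomorphism of directed graphs is a bijection of vertices such that it and its inverse preserve directed edges and their colors. *)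

theory Defs
  imports Complex_Main "HOL-Library.FuncSet" "Graph_Theory.Pair_Digraph"
begin

section \<open>Edge-colored digraphs\<close>

text \<open>The coloring is a relation between arcs and colors, because the colors of the Domino Game
  digraph are given by a condition on an arc and a color. That every arc has exactly one color is
  part of \<open>edge_colored_digraph\<close>.\<close>

record ('v, 'c) colored_digraph =
  digraph :: "'v pair_pre_digraph"
  has_color :: "'v \<times> 'v \<Rightarrow> 'c \<Rightarrow> bool"

abbreviation vertices :: "('v, 'c) colored_digraph \<Rightarrow> 'v set" where
  "vertices G \<equiv> pverts (digraph G)"

abbreviation edges :: "('v, 'c) colored_digraph \<Rightarrow> ('v \<times> 'v) set" where
  "edges G \<equiv> parcs (digraph G)"

definition edge_colored_digraph :: "'c set \<Rightarrow> ('v, 'c) colored_digraph \<Rightarrow> bool" where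
  "edge_colored_digraph C G \<longleftrightarrow>
     pair_wf_digraph (digraph G) \<and>
     (\<forall>e \<in> edges G. (\<exists>!i. has_color G e i) \<and> (\<forall>i. has_color G e i \<longrightarrow> i \<in> C))"

definition preserves_colored_edges ::
  "('v \<Rightarrow> 'w) \<Rightarrow> ('v, 'c) colored_digraph \<Rightarrow> ('w, 'c) colored_digraph \<Rightarrow> bool" where
  "preserves_colored_edges f G H \<longleftrightarrow>
     (\<forall>u v. (u, v) \<in> edges G \<longrightarrow>
        (f u, f v) \<in> edges H \<and>
        (\<forall>i. has_color G (u, v) i \<longrightarrow> has_color H (f u, f v) i))"

definition colored_digraph_iso ::
  "'c set \<Rightarrow> ('v \<Rightarrow> 'w) \<Rightarrow> ('v, 'c) colored_digraph \<Rightarrow> ('w, 'c) colored_digraph \<Rightarrow> bool" where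
  "colored_digraph_iso C f G H \<longleftrightarrow>
     edge_colored_digraph C G \<and> edge_colored_digraph C H \<and>
     bij_betw f (vertices G) (vertices H) \<and>
     preserves_colored_edges f G H \<and>
     preserves_colored_edges (inv_into (vertices G) f) H G"


section \<open>Partitions\<close>

text \<open>An integer sequence of length \<open>k\<close> is a function on \<open>{1..k}\<close>, extended by
  \<open>undefined\<close>, so that sequences are indexed from 1. Indices, \<open>k\<close> and \<open>N\<close> are of type
  \<open>int\<close>, so no subtraction truncates.\<close>

type_synonym int_seq = "int \<Rightarrow> int"

definition partitions :: "int \<Rightarrow> int \<Rightarrow> int_seq set" where
  "partitions k m =
     {\<sigma> \<in> {1..k} \<rightarrow>\<^sub>E {0..m}. \<forall>i\<in>{1..k}. \<forall>j\<in>{1..k}. i \<le> j \<longrightarrow> \<sigma> j \<le> \<sigma> i}"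


section \<open>The type A fundamental lattice\<close>

definition diff_is_unit :: "int \<Rightarrow> int_seq \<Rightarrow> int_seq \<Rightarrow> int \<Rightarrow> bool" where
  "diff_is_unit k \<sigma> \<tau> l \<longleftrightarrow>
     (\<forall>r\<in>{1..k}. \<tau> r - \<sigma> r = (if r = l then 1 else 0))"

definition L_part :: "int \<Rightarrow> int \<Rightarrow> (int_seq, int) colored_digraph" where
  "L_part k N = \<lparr>
     digraph = \<lparr>
       pverts = partitions k (N - k),
       parcs = {(\<sigma>, \<tau>). \<sigma> \<in> partitions k (N - k) \<and> \<tau> \<in> partitions k (N - k) \<and>
                         (\<exists>l\<in>{1..k}. diff_is_unit k \<sigma> \<tau> l)} \<rparr>,
     has_color = (\<lambda>(\<sigma>, \<tau>) i. \<exists>l\<in>{1..k}. diff_is_unit k \<sigma> \<tau> l \<and> i = N - k - \<tau> l + l) \<rparr>"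


section \<open>The Domino Game digraph\<close>

text \<open>A square is a pair (row, column). In \<open>red\<close>, \<open>m\<close> is the number of columns of the board.\<close>

definition shape :: "int \<Rightarrow> int_seq \<Rightarrow> (int \<times> int) set" where
  "shape k \<sigma> = {(r, c). 1 \<le> r \<and> r \<le> k \<and> 1 \<le> c \<and> c \<le> \<sigma> r}"

definition red :: "int \<Rightarrow> int \<times> int \<Rightarrow> bool" where
  "red m = (\<lambda>(r, c). (r + c) mod 2 = (1 + m) mod 2)"

abbreviation white :: "int \<Rightarrow> int \<times> int \<Rightarrow> bool" where
  "white m q \<equiv> \<not> red m q"

definition removable :: "int \<Rightarrow> (int \<times> int) set set" where
  "removable m =
     {{(r, c), (r, c + 1)} | r c. red m (r, c) \<and> white m (r, c + 1)} \<union>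
     {{(r, c), (r + 1, c)} | r c. white m (r, c) \<and> red m (r + 1, c)} \<union>
     {{(1, m)}}"

definition addable :: "int \<Rightarrow> (int \<times> int) set set" where
  "addable m =
     {{(r, c), (r, c + 1)} | r c. white m (r, c) \<and> red m (r, c + 1)} \<union>
     {{(r, c), (r + 1, c)} | r c. red m (r, c) \<and> white m (r + 1, c)}"

definition domino_move :: "int \<Rightarrow> int \<Rightarrow> int_seq \<Rightarrow> int_seq \<Rightarrow> bool" where
  "domino_move k m \<sigma> \<tau> \<longleftrightarrow>
     (\<exists>Q \<in> removable m. Q \<subseteq> shape k \<sigma> \<and> shape k \<tau> = shape k \<sigma> - Q) \<or>
     (\<exists>Q \<in> addable m. Q \<inter> shape k \<sigma> = {} \<and> shape k \<tau> = shape k \<sigma> \<union> Q)"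

definition S_set :: "int \<Rightarrow> int_seq \<Rightarrow> int set" where
  "S_set k \<sigma> = {\<sigma> j + k - j + 1 | j. j \<in> {1..k}}"

definition x_color :: "int \<Rightarrow> int \<Rightarrow> int" where
  "x_color N i =
     (if even N then (if i \<le> N div 2 then 2 * i - 1 else 2 * N - 2 * i + 2)
      else (if i \<le> N div 2 then 2 * i else 2 * N - 2 * i + 1))"

definition y_color :: "int \<Rightarrow> int \<Rightarrow> int" where
  "y_color N i =
     (if even N then
        (if i < N div 2 then 2 * i + 1 else if i = N div 2 then 2 * i else 2 * N - 2 * i)
      else
        (if i < N div 2 then 2 * i + 2 else if i = N div 2 then 2 * i + 1 else 2 * N - 2 * i - 1))"

definition D_part :: "int \<Rightarrow> int \<Rightarrow> (int_seq, int) colored_digraph" where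
  "D_part k N = \<lparr>
     digraph = \<lparr>
       pverts = partitions k (N - k),
       parcs = {(\<sigma>, \<tau>). \<sigma> \<in> partitions k (N - k) \<and> \<tau> \<in> partitions k (N - k) \<and>
                         domino_move k (N - k) \<sigma> \<tau>} \<rparr>,
     has_color = (\<lambda>(\<sigma>, \<tau>) i. i \<in> {1..N - 1} \<and>
        x_color N i \<in> S_set k \<tau> \<and> y_color N i \<notin> S_set k \<tau> \<and>
        S_set k \<sigma> = (S_set k \<tau> - {x_color N i}) \<union> {y_color N i}) \<rparr>"


section \<open>The maps between the two digraphs\<close>

text \<open>The permutation \<open>\<pi>\<close> of \<open>{1..N}\<close>; values outside of \<open>{1..N}\<close> are irrelevant.\<close>

definition perm_pi :: "int \<Rightarrow> int \<Rightarrow> int" where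
  "perm_pi N i =
     (if even N then (if i \<le> N div 2 then 2 * i - 1 else 2 * N - 2 * (i - 1))
      else (if i \<le> N div 2 then 2 * i else 2 * (N - i) + 1))"

text \<open>The \<open>j\<close>-th element, counted from 1, of a finite set listed in increasing or decreasing
  order.\<close>

definition nth_increasing :: "int set \<Rightarrow> int \<Rightarrow> int" where
  "nth_increasing A j = sorted_list_of_set A ! nat (j - 1)"

definition nth_decreasing :: "int set \<Rightarrow> int \<Rightarrow> int" where
  "nth_decreasing A j = rev (sorted_list_of_set A) ! nat (j - 1)"

definition T_set :: "int \<Rightarrow> int \<Rightarrow> int_seq \<Rightarrow> int set" where
  "T_set k N \<sigma> = {N - k + r - \<sigma> r | r. r \<in> {1..k}}"

definition Phi :: "int \<Rightarrow> int \<Rightarrow> int_seq \<Rightarrow> int_seq" where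
  "Phi k N \<sigma> =
     (\<lambda>j\<in>{1..k}. nth_decreasing (perm_pi N ` T_set k N \<sigma>) j - k + j - 1)"

definition Phi_inv :: "int \<Rightarrow> int \<Rightarrow> int_seq \<Rightarrow> int_seq" where
  "Phi_inv k N \<tau> =
     (\<lambda>r\<in>{1..k}. N - k + r - nth_increasing (inv_into {1..N} (perm_pi N) ` S_set k \<tau>) r)"

end

theory Submission
  imports Defs
begin

text \<open>Both digraphs become the same object once a partition is replaced by a \<open>k\<close>-element subset of
  \<open>{1..N}\<close>, to be thought of as \<open>k\<close> beads on a runner with \<open>N\<close> positions.

  A partition is determined by its bead set \<open>S_set\<close>, and every \<open>k\<close>-subset of \<open>{1..N}\<close> occurs
  (\<open>partition_of_S_set\<close>, \<open>S_set_partition_of\<close>); the set \<open>T_set\<close> is the mirror image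
  \<open>s \<mapsto> N + 1 - s\<close> of \<open>S_set\<close>. In these terms \<open>Phi\<close> is the map \<open>T \<mapsto> perm_pi N ` T\<close> on subsets,
  and so \<open>Phi_inv\<close>, which applies the inverse permutation, is its inverse.

  An edge of color \<open>i\<close> in the fundamental lattice adds a box, which moves one bead of the mirrored
  set by one position: it leaves \<open>i + 1\<close> and lands on the free position \<open>i\<close>
  (\<open>has_color_L_part\<close>). An edge of color \<open>i\<close> in the Domino Game digraph also moves one bead: adding a domino
  moves a bead up by two, a horizontal one if the position in between is free and a vertical one if
  it is occupied, while removing the corner square moves a bead from \<open>N\<close> to \<open>N - 1\<close>. The red and
  white squares say precisely that, in domino moves, beads of the parity of \<open>N\<close> move up and the
  others move down.
  Now \<open>perm_pi N\<close> lists the positions as follows: first those of the parity of \<open>N - 1\<close> in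
  increasing order, then those of the parity of \<open>N\<close> in decreasing order. Hence the legal moves are
  exactly those from \<open>perm_pi N (i + 1)\<close> to \<open>perm_pi N i\<close>, with \<open>i\<close> the color
  (\<open>domino_move_iff_moves_bead\<close>), that is, the images of the moves from \<open>i + 1\<close> to \<open>i\<close> in the
  fundamental lattice.\<close>

section \<open>Partitions as sets of beads\<close>

definition bead :: "int \<Rightarrow> int_seq \<Rightarrow> int \<Rightarrow> int" where
  "bead k \<sigma> j = \<sigma> j + k - j + 1"

lemma S_set_eq_image_bead: "S_set k \<sigma> = bead k \<sigma> ` {1..k}"
  by (auto simp: S_set_def bead_def)

lemma strictly_decreasing_gap:
  fixes f :: "int \<Rightarrow> int"
  assumes dec: "\<And>i j. i \<in> {1..k} \<Longrightarrow> j \<in> {1..k} \<Longrightarrow> i < j \<Longrightarrow> f j < f i"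
    and "1 \<le> i" "i \<le> j" "j \<le> k"
  shows "f j + (j - i) \<le> f i"
  using \<open>i \<le> j\<close> \<open>j \<le> k\<close>
proof (induction j rule: int_ge_induct)
  case base
  then show ?case by simp
next
  case (step j)
  have "f (j + 1) < f j" using dec[of j "j + 1"] step \<open>1 \<le> i\<close> by auto
  then show ?case using step by auto
qed

text \<open>Passing from \<open>\<sigma>\<close> to its beads turns weak monotonicity into strict monotonicity. Conversely,
  a strictly decreasing integer sequence drops by at least one per step, which is the room that the
  shift \<open>k - j + 1\<close> takes up; the same estimate turns the bounds on the beads into bounds on the
  parts.\<close>

lemma partitions_iff_beads:
  "\<sigma> \<in> partitions k m \<longleftrightarrow>
     \<sigma> \<in> extensional {1..k} \<and> bead k \<sigma> ` {1..k} \<subseteq> {1..k + m} \<and>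
     (\<forall>i\<in>{1..k}. \<forall>j\<in>{1..k}. i < j \<longrightarrow> bead k \<sigma> j < bead k \<sigma> i)"
proof
  assume "\<sigma> \<in> partitions k m"
  then have e: "\<sigma> \<in> extensional {1..k}" and b: "\<And>j. j \<in> {1..k} \<Longrightarrow> \<sigma> j \<in> {0..m}"
    and d: "\<And>i j. i \<in> {1..k} \<Longrightarrow> j \<in> {1..k} \<Longrightarrow> i \<le> j \<Longrightarrow> \<sigma> j \<le> \<sigma> i"
    by (auto simp: partitions_def PiE_def Pi_def)
  have "bead k \<sigma> j \<in> {1..k + m}" if "j \<in> {1..k}" for j
    using b[OF that] that by (auto simp: bead_def)
  moreover have "bead k \<sigma> j < bead k \<sigma> i" if "i \<in> {1..k}" "j \<in> {1..k}" "i < j" for i j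
    using d[of i j] that by (auto simp: bead_def)
  ultimately show "\<sigma> \<in> extensional {1..k} \<and> bead k \<sigma> ` {1..k} \<subseteq> {1..k + m} \<and>
     (\<forall>i\<in>{1..k}. \<forall>j\<in>{1..k}. i < j \<longrightarrow> bead k \<sigma> j < bead k \<sigma> i)"
    using e by blast
next
  assume a: "\<sigma> \<in> extensional {1..k} \<and> bead k \<sigma> ` {1..k} \<subseteq> {1..k + m} \<and>
     (\<forall>i\<in>{1..k}. \<forall>j\<in>{1..k}. i < j \<longrightarrow> bead k \<sigma> j < bead k \<sigma> i)"
  have gap: "bead k \<sigma> j + (j - i) \<le> bead k \<sigma> i" if "1 \<le> i" "i \<le> j" "j \<le> k" for i j
    using strictly_decreasing_gap[of k "bead k \<sigma>" i j] a that by blast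
  have "\<sigma> j \<in> {0..m}" if j: "j \<in> {1..k}" for j
  proof -
    have "bead k \<sigma> 1 \<in> {1..k + m}" "bead k \<sigma> k \<in> {1..k + m}"
      using a j by (auto simp: image_subset_iff)
    then show ?thesis using gap[of 1 j] gap[of j k] j by (auto simp: bead_def)
  qed
  moreover have "\<sigma> j \<le> \<sigma> i" if "i \<in> {1..k}" "j \<in> {1..k}" "i \<le> j" for i j
    using gap[of i j] that by (auto simp: bead_def)
  ultimately show "\<sigma> \<in> partitions k m"
    using a by (auto simp: partitions_def PiE_def Pi_def)
qed

lemma bead_strictly_decreasing:
  assumes "\<sigma> \<in> partitions k m" "i \<in> {1..k}" "j \<in> {1..k}"
  shows "bead k \<sigma> j < bead k \<sigma> i \<longleftrightarrow> i < j"
proof -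
  have "i < j \<Longrightarrow> bead k \<sigma> j < bead k \<sigma> i" "j < i \<Longrightarrow> bead k \<sigma> i < bead k \<sigma> j"
    using assms unfolding partitions_iff_beads by blast+
  then show ?thesis by (cases i j rule: linorder_cases) auto
qed

lemma inj_on_bead:
  assumes "\<sigma> \<in> partitions k m"
  shows "inj_on (bead k \<sigma>) {1..k}"
proof (rule inj_onI)
  fix i j assume "i \<in> {1..k}" "j \<in> {1..k}" "bead k \<sigma> i = bead k \<sigma> j"
  then show "i = j"
    using bead_strictly_decreasing[OF assms, of i j] bead_strictly_decreasing[OF assms, of j i]
    by linarith
qed

lemma nth_decreasing_image:
  fixes f :: "int \<Rightarrow> int"
  assumes dec: "\<And>i j. i \<in> {1..k} \<Longrightarrow> j \<in> {1..k} \<Longrightarrow> i < j \<Longrightarrow> f j < f i"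
    and j: "j \<in> {1..k}"
  shows "nth_decreasing (f ` {1..k}) j = f j"
proof -
  have "sorted_wrt (<) (rev (map f [1..k]))"
    unfolding sorted_wrt_rev sorted_wrt_map
    by (rule sorted_wrt_mono_rel[OF _ sorted_wrt_upto]) (use dec in auto)
  then have "sorted_list_of_set (set (rev (map f [1..k]))) = rev (map f [1..k])"
    by (metis sorted_list_of_set.idem_if_sorted_distinct strict_sorted_iff)
  then have "rev (sorted_list_of_set (f ` {1..k})) = map f [1..k]" by simp
  then show ?thesis using j by (simp add: nth_decreasing_def)
qed

lemma nth_decreasing_S_set:
  assumes "\<sigma> \<in> partitions k m" "j \<in> {1..k}"
  shows "nth_decreasing (S_set k \<sigma>) j = bead k \<sigma> j"
  unfolding S_set_eq_image_bead
  by (rule nth_decreasing_image) (use assms in \<open>simp_all add: bead_strictly_decreasing\<close>)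

lemma nth_decreasing_enumerates:
  fixes A :: "int set"
  assumes fin: "finite A" and card: "int (card A) = k"
  shows "nth_decreasing A ` {1..k} = A"
    and "\<And>i j. i \<in> {1..k} \<Longrightarrow> j \<in> {1..k} \<Longrightarrow> i < j \<Longrightarrow> nth_decreasing A j < nth_decreasing A i"
proof -
  let ?xs = "rev (sorted_list_of_set A)"
  have len: "length ?xs = nat k" using card by auto
  have idx: "(\<lambda>j. nat (j - 1)) ` {1..k} = {..<nat k}"
  proof
    show "{..<nat k} \<subseteq> (\<lambda>j. nat (j - 1)) ` {1..k}"
      by (rule subsetI, rule_tac x = "int x + 1" in image_eqI) auto
  qed auto
  have "nth_decreasing A ` {1..k} = (!) ?xs ` {..<nat k}"
    unfolding idx[symmetric] image_image nth_decreasing_def ..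
  also have "\<dots> = set ?xs"
    unfolding len[symmetric] by (auto simp: set_conv_nth image_def simp del: set_rev)
  finally show "nth_decreasing A ` {1..k} = A" using fin by simp
  have "sorted_wrt (\<lambda>x y. y < x) ?xs"
    unfolding sorted_wrt_rev by simp
  then show "nth_decreasing A j < nth_decreasing A i"
    if "i \<in> {1..k}" "j \<in> {1..k}" "i < j" for i j
    unfolding nth_decreasing_def by (rule sorted_wrt_nth_less) (use that len in auto)
qed

text \<open>The inverse of \<open>S_set\<close> on \<open>k\<close>-element sets.\<close>

definition partition_of :: "int \<Rightarrow> int set \<Rightarrow> int_seq" where
  "partition_of k A = (\<lambda>j\<in>{1..k}. nth_decreasing A j - k + j - 1)"

lemma bead_partition_of:
  "j \<in> {1..k} \<Longrightarrow> bead k (partition_of k A) j = nth_decreasing A j"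
  by (simp add: bead_def partition_of_def)

lemma partition_of_S_set:
  assumes "\<sigma> \<in> partitions k m"
  shows "partition_of k (S_set k \<sigma>) = \<sigma>"
proof
  fix j
  show "partition_of k (S_set k \<sigma>) j = \<sigma> j"
  proof (cases "j \<in> {1..k}")
    case True
    then show ?thesis
      using nth_decreasing_S_set[OF assms True] by (simp add: partition_of_def bead_def)
  next
    case False
    moreover have "\<sigma> \<in> extensional {1..k}" using assms unfolding partitions_iff_beads by blast
    ultimately have "\<sigma> j = undefined" by (metis extensional_arb)
    then show ?thesis unfolding partition_of_def using False by (simp only: restrict_apply if_False)
  qed
qed

lemma S_set_partition_of:
  assumes A: "A \<subseteq> {1..k + m}" "int (card A) = k"
  shows "partition_of k A \<in> partitions k m" and "S_set k (partition_of k A) = A"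
proof -
  have fin: "finite A" using A(1) by (rule finite_subset) simp
  note enum = nth_decreasing_enumerates[OF fin A(2)]
  have "bead k (partition_of k A) ` {1..k} = nth_decreasing A ` {1..k}"
    by (rule image_cong) (simp_all add: bead_partition_of)
  then have img: "bead k (partition_of k A) ` {1..k} = A" unfolding enum(1) .
  then show "S_set k (partition_of k A) = A" by (simp add: S_set_eq_image_bead)
  have "partition_of k A \<in> extensional {1..k}" by (simp add: partition_of_def)
  moreover have "bead k (partition_of k A) j < bead k (partition_of k A) i"
    if "i \<in> {1..k}" "j \<in> {1..k}" "i < j" for i j
    using enum(2)[OF that] that by (simp add: bead_partition_of)
  ultimately show "partition_of k A \<in> partitions k m"
    unfolding partitions_iff_beads img using A(1) by blast
qed

lemma S_set_subset: "\<sigma> \<in> partitions k m \<Longrightarrow> S_set k \<sigma> \<subseteq> {1..k + m}"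
  unfolding S_set_eq_image_bead partitions_iff_beads by blast

lemma card_S_set:
  assumes "\<sigma> \<in> partitions k m" "0 \<le> k"
  shows "int (card (S_set k \<sigma>)) = k"
  unfolding S_set_eq_image_bead card_image[OF inj_on_bead[OF assms(1)]] using assms(2) by simp

lemma inj_on_S_set: "inj_on (S_set k) (partitions k m)"
  by (rule inj_on_inverseI[where g = "partition_of k"]) (rule partition_of_S_set)

lemma T_set_eq_reflected_S_set: "T_set k N \<sigma> = (\<lambda>s. N + 1 - s) ` S_set k \<sigma>"
proof -
  have "T_set k N \<sigma> = (\<lambda>r. N - k + r - \<sigma> r) ` {1..k}" by (auto simp: T_set_def)
  also have "\<dots> = (\<lambda>s. N + 1 - s) ` S_set k \<sigma>"
    unfolding S_set_eq_image_bead image_image by (simp add: bead_def algebra_simps)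
  finally show ?thesis .
qed

lemma nth_increasing_reflect:
  fixes A :: "int set"
  assumes "finite A" "j \<in> {1..int (card A)}"
  shows "nth_increasing ((\<lambda>s. c - s) ` A) j = c - nth_decreasing A j"
proof -
  let ?xs = "map (\<lambda>s. c - s) (rev (sorted_list_of_set A))"
  have "sorted_wrt (<) ?xs"
    unfolding sorted_wrt_map sorted_wrt_rev by simp
  then have "sorted_list_of_set (set ?xs) = ?xs"
    by (metis sorted_list_of_set.idem_if_sorted_distinct strict_sorted_iff)
  then have "sorted_list_of_set ((\<lambda>s. c - s) ` A) = ?xs" using assms(1) by simp
  moreover have "nat (j - 1) < length (rev (sorted_list_of_set A))" using assms by auto
  ultimately show ?thesis by (simp only: nth_increasing_def nth_decreasing_def nth_map)
qed

section \<open>Moving one bead\<close>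

definition moves_bead :: "'a set \<Rightarrow> 'a \<Rightarrow> 'a \<Rightarrow> 'a set \<Rightarrow> bool" where
  "moves_bead A x y B \<longleftrightarrow> x \<in> A \<and> y \<notin> A \<and> B = (A - {x}) \<union> {y}"

lemma moves_bead_sym: "moves_bead A x y B \<longleftrightarrow> moves_bead B y x A"
  unfolding moves_bead_def by auto

text \<open>Bead moves are transported along injections; this is what carries the moves of the fundamental
  lattice over to those of the Domino Game along \<open>perm_pi\<close>.\<close>

lemma moves_bead_image:
  assumes "inj_on f I" "A \<subseteq> I" "B \<subseteq> I" "x \<in> I" "y \<in> I"
  shows "moves_bead (f ` A) (f x) (f y) (f ` B) \<longleftrightarrow> moves_bead A x y B"
proof -
  have "f ` (A - {x} \<union> {y}) = f ` A - {f x} \<union> {f y}"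
  proof -
    have "f ` (A - {x}) = f ` A - f ` {x}"
      by (rule inj_on_image_set_diff[OF assms(1)]) (use assms(2,4) in auto)
    then show ?thesis by (simp add: image_Un)
  qed
  moreover have "f ` B = f ` (A - {x} \<union> {y}) \<longleftrightarrow> B = A - {x} \<union> {y}"
    by (rule inj_on_image_eq_iff[OF assms(1)]) (use assms(2-5) in blast)+
  ultimately show ?thesis
    unfolding moves_bead_def
    using inj_on_image_mem_iff[OF assms(1,4,2)] inj_on_image_mem_iff[OF assms(1,5,2)] by simp
qed

lemma moves_bead_unique:
  assumes "moves_bead A x y B" "moves_bead A x' y' B"
  shows "x = x'"
  using assms unfolding moves_bead_def by blast

lemma moves_bead_fun_upd:
  assumes "inj_on f I" "inj_on (f(r := v)) I" "r \<in> I" "v \<noteq> f r"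
  shows "moves_bead (f ` I) (f r) v (f(r := v) ` I)"
proof -
  have "v \<notin> f ` I"
  proof
    assume "v \<in> f ` I"
    then obtain j where j: "j \<in> I" "f j = v" by auto
    with assms(4) have "j \<noteq> r" by auto
    with j have "(f(r := v)) j = (f(r := v)) r" by simp
    with \<open>j \<noteq> r\<close> j assms(2,3) show False by (metis inj_onD)
  qed
  moreover have "f(r := v) ` I = f ` I - {f r} \<union> {v}"
    using assms(1,3) by (auto simp: inj_on_def)
  ultimately show ?thesis using assms(3) by (simp add: moves_bead_def)
qed

lemma bead_fun_upd: "bead k (\<sigma>(r := v)) = (bead k \<sigma>)(r := v + k - r + 1)"
  by (auto simp: bead_def)

text \<open>A bead that moves up by \<open>d\<close> without passing another bead keeps its rank, so only one part
  changes, namely by \<open>d\<close>. The case \<open>d = 1\<close> is the addition of a box, and \<open>d = 2\<close> that of a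
  horizontal domino.\<close>

lemma moves_bead_free_iff:
  assumes \<rho>: "\<rho> \<in> partitions k m" and \<sigma>: "\<sigma> \<in> partitions k m" and d: "0 < d"
  shows "(moves_bead (S_set k \<rho>) b (b + d) (S_set k \<sigma>) \<and> (\<forall>x. b < x \<and> x < b + d \<longrightarrow> x \<notin> S_set k \<rho>))
     \<longleftrightarrow> (\<exists>r\<in>{1..k}. b = bead k \<rho> r \<and> \<sigma> = \<rho>(r := \<rho> r + d))" (is "?L \<longleftrightarrow> ?R")
proof
  assume ?R
  then obtain r where r: "r \<in> {1..k}" "b = bead k \<rho> r" and \<sigma>_eq: "\<sigma> = \<rho>(r := \<rho> r + d)" by auto
  have bead_\<sigma>: "bead k \<sigma> = (bead k \<rho>)(r := b + d)"
    unfolding \<sigma>_eq bead_fun_upd r(2) by (simp add: bead_def algebra_simps)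
  have "moves_bead (S_set k \<rho>) b (b + d) (S_set k \<sigma>)"
    using moves_bead_fun_upd[of "bead k \<rho>" "{1..k}" r "b + d"] inj_on_bead[OF \<rho>] inj_on_bead[OF \<sigma>]
      r d by (simp add: S_set_eq_image_bead bead_\<sigma>)
  moreover have "x \<notin> S_set k \<rho>" if x: "b < x" "x < b + d" for x
  proof
    assume "x \<in> S_set k \<rho>"
    then obtain j where j: "j \<in> {1..k}" "x = bead k \<rho> j" by (auto simp: S_set_eq_image_bead)
    with x r have "j < r" using bead_strictly_decreasing[OF \<rho>, of j r] by auto
    then have "bead k \<sigma> r < bead k \<sigma> j" using bead_strictly_decreasing[OF \<sigma>, of j r] j r by auto
    with \<open>j < r\<close> j x show False by (auto simp: bead_\<sigma>)
  qed
  ultimately show ?L by blast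
next
  assume L: ?L
  then obtain r where r: "r \<in> {1..k}" "b = bead k \<rho> r"
    by (auto simp: moves_bead_def S_set_eq_image_bead)
  \<comment> \<open>It suffices that the expected result \<open>\<sigma>'\<close> is a partition: its bead set is that of \<open>\<sigma>\<close>.\<close>
  define \<sigma>' where "\<sigma>' = \<rho>(r := \<rho> r + d)"
  have bead_\<sigma>': "bead k \<sigma>' = (bead k \<rho>)(r := b + d)"
    unfolding \<sigma>'_def bead_fun_upd r(2) by (simp add: bead_def algebra_simps)
  have free: "x \<notin> S_set k \<rho>" if "b < x" "x \<le> b + d" for x
    using L that by (cases "x = b + d") (auto simp: moves_bead_def)
  have "b + d \<in> {1..k + m}"
    using L S_set_subset[OF \<sigma>] by (auto simp: moves_bead_def)
  then have "bead k \<sigma>' ` {1..k} \<subseteq> {1..k + m}"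
    using \<rho> by (auto simp: bead_\<sigma>' partitions_iff_beads)
  moreover have "bead k \<sigma>' j < bead k \<sigma>' i" if ij: "i \<in> {1..k}" "j \<in> {1..k}" "i < j" for i j
  proof -
    have "bead k \<rho> j < bead k \<rho> i" using bead_strictly_decreasing[OF \<rho>] ij by auto
    moreover have "bead k \<rho> i \<in> S_set k \<rho>" using ij by (auto simp: S_set_eq_image_bead)
    ultimately show ?thesis
      using free[of "bead k \<rho> i"] d r(2) ij(3) by (fastforce simp: bead_\<sigma>')
  qed
  moreover have "\<sigma>' \<in> extensional {1..k}"
    using \<rho> r by (auto simp: \<sigma>'_def partitions_iff_beads extensional_def)
  ultimately have \<sigma>': "\<sigma>' \<in> partitions k m" by (simp add: partitions_iff_beads)
  have "moves_bead (S_set k \<rho>) b (b + d) (S_set k \<sigma>')"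
    using moves_bead_fun_upd[of "bead k \<rho>" "{1..k}" r "b + d"] inj_on_bead[OF \<rho>] inj_on_bead[OF \<sigma>']
      r d by (simp add: S_set_eq_image_bead bead_\<sigma>')
  with L have "S_set k \<sigma> = S_set k \<sigma>'" by (simp add: moves_bead_def)
  with \<sigma> \<sigma>' have "\<sigma> = \<sigma>'" by (metis inj_on_S_set inj_onD)
  then show ?R using r by (auto simp: \<sigma>'_def)
qed

lemma moves_bead_1_iff:
  assumes "\<rho> \<in> partitions k m" "\<sigma> \<in> partitions k m"
  shows "moves_bead (S_set k \<rho>) b (b + 1) (S_set k \<sigma>)
     \<longleftrightarrow> (\<exists>r\<in>{1..k}. b = bead k \<rho> r \<and> \<sigma> = \<rho>(r := \<rho> r + 1))"
  using moves_bead_free_iff[OF assms, of 1 b] by auto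

text \<open>If a bead jumps over its occupied neighbor, the two exchange ranks, so that in decreasing order
  each of two consecutive beads grows by one: a vertical domino is added to two equal rows.\<close>

lemma moves_bead_jump:
  assumes \<rho>: "\<rho> \<in> partitions k m" and \<sigma>: "\<sigma> \<in> partitions k m"
    and r: "r \<in> {1..k}" "r + 1 \<in> {1..k}" "\<rho> (r + 1) = \<rho> r" "b = bead k \<rho> (r + 1)"
    and \<sigma>_eq: "\<sigma> = \<rho>(r := \<rho> r + 1, r + 1 := \<rho> (r + 1) + 1)"
  shows "moves_bead (S_set k \<rho>) b (b + 2) (S_set k \<sigma>) \<and> b + 1 \<in> S_set k \<rho>"
proof -
  have br: "bead k \<rho> r = b + 1" using r by (simp add: bead_def)
  have bead_\<sigma>: "bead k \<sigma> = (bead k \<rho>)(r := b + 2, r + 1 := b + 1)"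
    unfolding \<sigma>_eq bead_fun_upd r(4) using r(3) by (auto simp: bead_def)
  have "b + 2 \<notin> S_set k \<rho>"
  proof
    assume "b + 2 \<in> S_set k \<rho>"
    then obtain j where j: "j \<in> {1..k}" "b + 2 = bead k \<rho> j" by (auto simp: S_set_eq_image_bead)
    with br r have "j \<noteq> r" "j \<noteq> r + 1" by auto
    with j have "bead k \<sigma> j = bead k \<sigma> r" by (simp add: bead_\<sigma>)
    with \<open>j \<noteq> r\<close> j r inj_on_bead[OF \<sigma>] show False by (metis inj_onD)
  qed
  moreover have "bead k \<sigma> ` {1..k} = bead k \<rho> ` {1..k} - {b} \<union> {b + 2}"
  proof -
    have "bead k \<sigma> ` {1..k} = bead k \<rho> ` ({1..k} - {r, r + 1}) \<union> {b + 2, b + 1}"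
      using r(1,2) by (auto simp: bead_\<sigma>)
    also have "\<dots> = (bead k \<rho> ` {1..k} - {b + 1, b}) \<union> {b + 2, b + 1}"
    proof -
      have "bead k \<rho> ` ({1..k} - {r, r + 1}) = bead k \<rho> ` {1..k} - bead k \<rho> ` {r, r + 1}"
        by (rule inj_on_image_set_diff[OF inj_on_bead[OF \<rho>]]) (use r(1,2) in auto)
      also have "bead k \<rho> ` {r, r + 1} = {b + 1, b}" using br r(4) by simp
      finally show ?thesis by simp
    qed
    also have "\<dots> = bead k \<rho> ` {1..k} - {b} \<union> {b + 2}"
    proof -
      have "b + 1 \<in> bead k \<rho> ` {1..k}" using r(1) br[symmetric] by (rule_tac image_eqI)
      then show ?thesis by auto
    qed
    finally show ?thesis .
  qed
  moreover have "b \<in> S_set k \<rho>" "b + 1 \<in> S_set k \<rho>"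
    unfolding S_set_eq_image_bead using r(1,2,4) br by (metis imageI)+
  ultimately show ?thesis by (simp add: moves_bead_def S_set_eq_image_bead)
qed

lemma moves_bead_jump_iff:
  assumes \<rho>: "\<rho> \<in> partitions k m" and \<sigma>: "\<sigma> \<in> partitions k m"
  shows "(moves_bead (S_set k \<rho>) b (b + 2) (S_set k \<sigma>) \<and> b + 1 \<in> S_set k \<rho>)
     \<longleftrightarrow> (\<exists>r. r \<in> {1..k} \<and> r + 1 \<in> {1..k} \<and> \<rho> (r + 1) = \<rho> r \<and> b = bead k \<rho> (r + 1) \<and>
              \<sigma> = \<rho>(r := \<rho> r + 1, r + 1 := \<rho> (r + 1) + 1))" (is "?L \<longleftrightarrow> ?R")
proof
  assume ?R
  then show ?L using moves_bead_jump[OF \<rho> \<sigma>] by blast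
next
  assume L: ?L
  then obtain r' r where r': "r' \<in> {1..k}" "b = bead k \<rho> r'" and r: "r \<in> {1..k}" "b + 1 = bead k \<rho> r"
    by (auto simp: moves_bead_def S_set_eq_image_bead)
  have "r < r'" using bead_strictly_decreasing[OF \<rho> r(1) r'(1)] r r' by auto
  have r'_eq: "r' = r + 1"
  proof (rule ccontr)
    assume "r' \<noteq> r + 1"
    with \<open>r < r'\<close> have "r + 1 < r'" by simp
    then show False
      using bead_strictly_decreasing[OF \<rho>, of "r + 1" r'] bead_strictly_decreasing[OF \<rho>, of r "r + 1"]
        r r' by auto
  qed
  define \<sigma>' where "\<sigma>' = \<rho>(r := \<rho> r + 1, r + 1 := \<rho> (r + 1) + 1)"
  have eq: "\<rho> (r + 1) = \<rho> r" using r r' by (simp add: r'_eq bead_def)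
  have bead_\<sigma>': "bead k \<sigma>' = (bead k \<rho>)(r := b + 2, r + 1 := b + 1)"
    unfolding \<sigma>'_def bead_fun_upd r'(2) r'_eq using eq by (auto simp: bead_def)
  have "{b + 1, b + 2} \<subseteq> {1..k + m}"
    using L S_set_subset[OF \<sigma>] S_set_subset[OF \<rho>] by (auto simp: moves_bead_def)
  then have "bead k \<sigma>' ` {1..k} \<subseteq> {1..k + m}"
    using \<rho> by (auto simp: bead_\<sigma>' partitions_iff_beads)
  moreover have "bead k \<sigma>' j < bead k \<sigma>' i" if ij: "i \<in> {1..k}" "j \<in> {1..k}" "i < j" for i j
  proof -
    have "bead k \<rho> j < bead k \<rho> i" using bead_strictly_decreasing[OF \<rho>] ij by auto
    moreover have "bead k \<rho> i \<noteq> b + 2"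
    proof -
      have "bead k \<rho> i \<in> S_set k \<rho>" using ij(1) by (simp add: S_set_eq_image_bead)
      then show ?thesis using L by (auto simp: moves_bead_def)
    qed
    moreover have "i \<noteq> r \<Longrightarrow> bead k \<rho> i \<noteq> b + 1"
      using ij r inj_on_bead[OF \<rho>] by (metis inj_onD)
    ultimately show ?thesis
      using r'(2) r(2) ij(3) r'_eq by (auto simp: bead_\<sigma>')
  qed
  moreover have "\<sigma>' \<in> extensional {1..k}"
    using \<rho> r r' r'_eq by (auto simp: \<sigma>'_def partitions_iff_beads extensional_def)
  ultimately have \<sigma>': "\<sigma>' \<in> partitions k m" by (simp add: partitions_iff_beads)
  have "moves_bead (S_set k \<rho>) b (b + 2) (S_set k \<sigma>')"
    using moves_bead_jump[OF \<rho> \<sigma>', of r b] r r' eq r'_eq \<sigma>'_def by blast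
  with L have "S_set k \<sigma> = S_set k \<sigma>'" by (simp add: moves_bead_def)
  with \<sigma> \<sigma>' have "\<sigma> = \<sigma>'" by (metis inj_on_S_set inj_onD)
  then show ?R using r r' eq r'_eq by (auto simp: \<sigma>'_def)
qed

section \<open>Dominoes\<close>

text \<open>Removing squares from \<open>\<sigma>\<close> to get \<open>\<tau>\<close> is adding them to \<open>\<tau>\<close>, so this one relation serves both
  kinds of moves.\<close>

definition adds_squares :: "int \<Rightarrow> (int \<times> int) set \<Rightarrow> int_seq \<Rightarrow> int_seq \<Rightarrow> bool" where
  "adds_squares k Q \<rho> \<sigma> \<longleftrightarrow> Q \<inter> shape k \<rho> = {} \<and> shape k \<sigma> = shape k \<rho> \<union> Q"

lemma domino_move_iff_adds_squares:
  "domino_move k m \<sigma> \<tau> \<longleftrightarrow>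
     (\<exists>Q\<in>removable m. adds_squares k Q \<tau> \<sigma>) \<or> (\<exists>Q\<in>addable m. adds_squares k Q \<sigma> \<tau>)"
proof -
  have "Q \<subseteq> shape k \<sigma> \<and> shape k \<tau> = shape k \<sigma> - Q \<longleftrightarrow> adds_squares k Q \<tau> \<sigma>" for Q
    unfolding adds_squares_def by auto
  then show ?thesis by (simp add: domino_move_def adds_squares_def)
qed

lemma adds_squares_iff_skew_shape:
  assumes "\<rho> \<in> partitions k m" "\<sigma> \<in> partitions k m"
  shows "adds_squares k Q \<rho> \<sigma> \<longleftrightarrow>
     (\<forall>s\<in>{1..k}. \<rho> s \<le> \<sigma> s) \<and> (\<forall>s c. (s, c) \<in> Q \<longleftrightarrow> s \<in> {1..k} \<and> \<rho> s < c \<and> c \<le> \<sigma> s)"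
  (is "?L \<longleftrightarrow> ?R")
proof
  have nonneg: "0 \<le> \<rho> s" "0 \<le> \<sigma> s" if "s \<in> {1..k}" for s
    using assms that by (auto simp: partitions_def PiE_def Pi_def)
  {
    assume a: "adds_squares k Q \<rho> \<sigma>"
    have le: "\<rho> s \<le> \<sigma> s" if s: "s \<in> {1..k}" for s
    proof (cases "\<rho> s = 0")
      case False
      then have "(s, \<rho> s) \<in> shape k \<rho>" using nonneg(1)[OF s] s by (auto simp: shape_def)
      then have "(s, \<rho> s) \<in> shape k \<sigma>" using a by (auto simp: adds_squares_def)
      then show ?thesis by (simp add: shape_def)
    qed (use nonneg(2)[OF s] in simp)
    have "Q = shape k \<sigma> - shape k \<rho>" using a by (auto simp: adds_squares_def)
    also have "\<dots> = {(s, c). s \<in> {1..k} \<and> \<rho> s < c \<and> c \<le> \<sigma> s}"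
      using nonneg by (fastforce simp: shape_def)
    finally show ?R using le by blast
  }
  assume R: ?R
  have "((s, x) \<in> shape k \<sigma> \<longleftrightarrow> (s, x) \<in> shape k \<rho> \<or> (s, x) \<in> Q) \<and>
    \<not> ((s, x) \<in> Q \<and> (s, x) \<in> shape k \<rho>)" for s x
  proof (cases "s \<in> {1..k}")
    case True
    then have "\<rho> s \<le> \<sigma> s" using R by blast
    then show ?thesis
      unfolding conjunct2[OF R, THEN spec, THEN spec] shape_def using True nonneg[OF True] by auto
  next
    case False
    then show ?thesis
      unfolding conjunct2[OF R, THEN spec, THEN spec] shape_def by auto
  qed
  then show ?L unfolding adds_squares_def by auto
qed

lemma partition_ext:
  assumes "\<sigma> \<in> partitions k m" "\<tau> \<in> extensional {1..k}" "\<And>s. s \<in> {1..k} \<Longrightarrow> \<sigma> s = \<tau> s"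
  shows "\<sigma> = \<tau>"
  using assms by (auto simp: partitions_iff_beads intro: extensionalityI)

lemma extensional_fun_upd: "f \<in> extensional I \<Longrightarrow> r \<in> I \<Longrightarrow> f(r := v) \<in> extensional I"
  by (auto simp: extensional_def)

lemma extensional_partition: "\<sigma> \<in> partitions k m \<Longrightarrow> \<sigma> \<in> extensional {1..k}"
  by (simp add: partitions_iff_beads)

lemma adds_square_iff:
  assumes \<rho>: "\<rho> \<in> partitions k m" and \<sigma>: "\<sigma> \<in> partitions k m"
  shows "adds_squares k {(r, c)} \<rho> \<sigma> \<longleftrightarrow> r \<in> {1..k} \<and> c = \<rho> r + 1 \<and> \<sigma> = \<rho>(r := \<rho> r + 1)"
proof
  assume "adds_squares k {(r, c)} \<rho> \<sigma>"
  note skew = this[unfolded adds_squares_iff_skew_shape[OF assms]]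
  note le = conjunct1[OF skew, THEN bspec]
  have Q: "(s = r \<and> x = c) \<longleftrightarrow> (s \<in> {1..k} \<and> \<rho> s < x \<and> x \<le> \<sigma> s)" for s x
    unfolding conjunct2[OF skew, THEN spec, THEN spec, symmetric] by auto
  have r: "r \<in> {1..k}" and c: "c = \<rho> r + 1" "\<sigma> r = \<rho> r + 1"
    using Q[of r c] Q[of r "\<rho> r + 1"] Q[of r "\<sigma> r"] by auto
  have "\<sigma> s = \<rho> s" if "s \<in> {1..k}" "s \<noteq> r" for s
    using Q[of s "\<sigma> s"] le[of s] that by auto
  with r c have "\<sigma> = \<rho>(r := \<rho> r + 1)"
    by (intro partition_ext[OF \<sigma>] extensional_fun_upd extensional_partition[OF \<rho>]) auto
  with r c show "r \<in> {1..k} \<and> c = \<rho> r + 1 \<and> \<sigma> = \<rho>(r := \<rho> r + 1)" by simp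
next
  assume R: "r \<in> {1..k} \<and> c = \<rho> r + 1 \<and> \<sigma> = \<rho>(r := \<rho> r + 1)"
  then have \<sigma>_eq: "\<sigma> s = (if s = r then \<rho> r + 1 else \<rho> s)" for s by simp
  from R have rc: "r \<in> {1..k}" "c = \<rho> r + 1" by blast+
  show "adds_squares k {(r, c)} \<rho> \<sigma>"
    unfolding adds_squares_iff_skew_shape[OF assms] \<sigma>_eq using rc by (auto split: if_splits)
qed

lemma adds_horizontal_domino_iff:
  assumes \<rho>: "\<rho> \<in> partitions k m" and \<sigma>: "\<sigma> \<in> partitions k m"
  shows "adds_squares k {(r, c), (r, c + 1)} \<rho> \<sigma> \<longleftrightarrow>
    r \<in> {1..k} \<and> c = \<rho> r + 1 \<and> \<sigma> = \<rho>(r := \<rho> r + 2)"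
proof
  assume "adds_squares k {(r, c), (r, c + 1)} \<rho> \<sigma>"
  note skew = this[unfolded adds_squares_iff_skew_shape[OF assms]]
  note le = conjunct1[OF skew, THEN bspec]
  have Q: "(s = r \<and> (x = c \<or> x = c + 1)) \<longleftrightarrow> (s \<in> {1..k} \<and> \<rho> s < x \<and> x \<le> \<sigma> s)" for s x
    unfolding conjunct2[OF skew, THEN spec, THEN spec, symmetric] by auto
  have r: "r \<in> {1..k}" and c: "c = \<rho> r + 1" "\<sigma> r = \<rho> r + 2"
    using Q[of r c] Q[of r "c + 1"] Q[of r "\<rho> r + 1"] Q[of r "\<sigma> r"] by auto
  have "\<sigma> s = \<rho> s" if "s \<in> {1..k}" "s \<noteq> r" for s
    using Q[of s "\<sigma> s"] le[of s] that by auto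
  with r c have "\<sigma> = \<rho>(r := \<rho> r + 2)"
    by (intro partition_ext[OF \<sigma>] extensional_fun_upd extensional_partition[OF \<rho>]) auto
  with r c show "r \<in> {1..k} \<and> c = \<rho> r + 1 \<and> \<sigma> = \<rho>(r := \<rho> r + 2)" by simp
next
  assume R: "r \<in> {1..k} \<and> c = \<rho> r + 1 \<and> \<sigma> = \<rho>(r := \<rho> r + 2)"
  then have \<sigma>_eq: "\<sigma> s = (if s = r then \<rho> r + 2 else \<rho> s)" for s by simp
  from R have rc: "r \<in> {1..k}" "c = \<rho> r + 1" by blast+
  show "adds_squares k {(r, c), (r, c + 1)} \<rho> \<sigma>"
    unfolding adds_squares_iff_skew_shape[OF assms] \<sigma>_eq using rc by (auto split: if_splits)
qed

lemma adds_vertical_domino_iff: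
  assumes \<rho>: "\<rho> \<in> partitions k m" and \<sigma>: "\<sigma> \<in> partitions k m"
  shows "adds_squares k {(r, c), (r + 1, c)} \<rho> \<sigma> \<longleftrightarrow>
    r \<in> {1..k} \<and> r + 1 \<in> {1..k} \<and> \<rho> (r + 1) = \<rho> r \<and> c = \<rho> r + 1 \<and>
    \<sigma> = \<rho>(r := \<rho> r + 1, r + 1 := \<rho> (r + 1) + 1)"
proof
  assume "adds_squares k {(r, c), (r + 1, c)} \<rho> \<sigma>"
  note skew = this[unfolded adds_squares_iff_skew_shape[OF assms]]
  note le = conjunct1[OF skew, THEN bspec]
  have Q: "((s = r \<or> s = r + 1) \<and> x = c) \<longleftrightarrow> (s \<in> {1..k} \<and> \<rho> s < x \<and> x \<le> \<sigma> s)" for s x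
    unfolding conjunct2[OF skew, THEN spec, THEN spec, symmetric] by auto
  have r: "r \<in> {1..k}" and c: "c = \<rho> r + 1" "\<sigma> r = \<rho> r + 1"
    using Q[of r c] Q[of r "\<rho> r + 1"] Q[of r "\<sigma> r"] by auto
  have r': "r + 1 \<in> {1..k}" and c': "c = \<rho> (r + 1) + 1" "\<sigma> (r + 1) = \<rho> (r + 1) + 1"
    using Q[of "r + 1" c] Q[of "r + 1" "\<rho> (r + 1) + 1"] Q[of "r + 1" "\<sigma> (r + 1)"] by auto
  have "\<sigma> s = \<rho> s" if "s \<in> {1..k}" "s \<noteq> r" "s \<noteq> r + 1" for s
    using Q[of s "\<sigma> s"] le[of s] that by auto
  with r r' c c' have "\<sigma> = \<rho>(r := \<rho> r + 1, r + 1 := \<rho> (r + 1) + 1)"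
    by (intro partition_ext[OF \<sigma>] extensional_fun_upd extensional_partition[OF \<rho>]) auto
  with r r' c c' show "r \<in> {1..k} \<and> r + 1 \<in> {1..k} \<and> \<rho> (r + 1) = \<rho> r \<and> c = \<rho> r + 1 \<and>
    \<sigma> = \<rho>(r := \<rho> r + 1, r + 1 := \<rho> (r + 1) + 1)" by simp
next
  assume R: "r \<in> {1..k} \<and> r + 1 \<in> {1..k} \<and> \<rho> (r + 1) = \<rho> r \<and> c = \<rho> r + 1 \<and>
    \<sigma> = \<rho>(r := \<rho> r + 1, r + 1 := \<rho> (r + 1) + 1)"
  then have \<sigma>_eq: "\<sigma> s = (if s = r \<or> s = r + 1 then \<rho> r + 1 else \<rho> s)" for s by simp
  from R have rc: "r \<in> {1..k}" "r + 1 \<in> {1..k}" "\<rho> (r + 1) = \<rho> r" "c = \<rho> r + 1" by blast+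
  show "adds_squares k {(r, c), (r + 1, c)} \<rho> \<sigma>"
    unfolding adds_squares_iff_skew_shape[OF assms] \<sigma>_eq using rc by (auto split: if_splits)
qed

lemma red_iff_even: "red m (r, c) \<longleftrightarrow> even (r + c + m + 1)"
  unfolding red_def by (simp add: mod2_eq_if)

text \<open>The first square of the domino determines the parity of the position \<open>b\<close> that the bead leaves.
  For a horizontal domino the bead of row \<open>r\<close> leaves \<open>b\<close>; for a vertical one it is the bead of row
  \<open>r + 1\<close>, one position below the bead of row \<open>r\<close>. This shift compensates the opposite coloring of
  vertical dominoes, so both kinds of dominoes give the same parity of \<open>b\<close>.\<close>

lemma adds_domino_iff_moves_bead:
  assumes \<rho>: "\<rho> \<in> partitions k m" and \<sigma>: "\<sigma> \<in> partitions k m"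
  shows "(\<exists>r c. red m (r, c) = p \<and> adds_squares k {(r, c), (r, c + 1)} \<rho> \<sigma>) \<or>
      (\<exists>r c. red m (r, c) = (\<not> p) \<and> adds_squares k {(r, c), (r + 1, c)} \<rho> \<sigma>) \<longleftrightarrow>
    (\<exists>b. odd (b + k + m) = p \<and> moves_bead (S_set k \<rho>) b (b + 2) (S_set k \<sigma>))"
proof -
  have free: "moves_bead (S_set k \<rho>) b (b + 2) (S_set k \<sigma>) \<and> b + 1 \<notin> S_set k \<rho> \<longleftrightarrow>
    (\<exists>r\<in>{1..k}. b = bead k \<rho> r \<and> \<sigma> = \<rho>(r := \<rho> r + 2))" for b
  proof -
    have "b < x \<and> x < b + 2 \<longleftrightarrow> x = b + 1" for x by auto
    then show ?thesis using moves_bead_free_iff[OF assms, of 2 b] by simp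
  qed
  have h: "(\<exists>r c. red m (r, c) = p \<and> adds_squares k {(r, c), (r, c + 1)} \<rho> \<sigma>) \<longleftrightarrow>
    (\<exists>b. odd (b + k + m) = p \<and>
       moves_bead (S_set k \<rho>) b (b + 2) (S_set k \<sigma>) \<and> b + 1 \<notin> S_set k \<rho>)"
  proof -
    have "red m (r, \<rho> r + 1) \<longleftrightarrow> odd (bead k \<rho> r + k + m)" for r
      unfolding red_iff_even bead_def by presburger
    then show ?thesis
      unfolding adds_horizontal_domino_iff[OF assms] free by blast
  qed
  have v: "(\<exists>r c. red m (r, c) = (\<not> p) \<and> adds_squares k {(r, c), (r + 1, c)} \<rho> \<sigma>) \<longleftrightarrow>
    (\<exists>b. odd (b + k + m) = p \<and>
       moves_bead (S_set k \<rho>) b (b + 2) (S_set k \<sigma>) \<and> b + 1 \<in> S_set k \<rho>)"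
  proof -
    have "\<rho> (r + 1) = \<rho> r \<Longrightarrow> red m (r, \<rho> r + 1) \<longleftrightarrow> even (bead k \<rho> (r + 1) + k + m)" for r
      unfolding red_iff_even bead_def by presburger
    then show ?thesis
      unfolding adds_vertical_domino_iff[OF assms] moves_bead_jump_iff[OF assms] by blast
  qed
  show ?thesis unfolding h v by blast
qed

lemma removable_iff_moves_bead:
  assumes \<tau>: "\<tau> \<in> partitions k m" and \<sigma>: "\<sigma> \<in> partitions k m" and k: "1 \<le> k"
  shows "(\<exists>Q\<in>removable m. adds_squares k Q \<tau> \<sigma>) \<longleftrightarrow>
    (\<exists>b. odd (b + k + m) \<and> moves_bead (S_set k \<tau>) b (b + 2) (S_set k \<sigma>)) \<or>
    moves_bead (S_set k \<tau>) (k + m - 1) (k + m) (S_set k \<sigma>)"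
proof -
  have corner: "adds_squares k {(1, m)} \<tau> \<sigma> \<longleftrightarrow>
    moves_bead (S_set k \<tau>) (k + m - 1) (k + m) (S_set k \<sigma>)"
  proof -
    \<comment> \<open>A bead that reaches the last position \<open>k + m\<close> can only be the one of the first row.\<close>
    have top: "r = 1" if "r \<in> {1..k}" "k + m - 1 = bead k \<tau> r" "\<sigma> = \<tau>(r := \<tau> r + 1)" for r
    proof -
      have "\<sigma> r \<le> m" using \<sigma> that(1) by (auto simp: partitions_def PiE_def Pi_def)
      with that show ?thesis by (auto simp: bead_def)
    qed
    have "moves_bead (S_set k \<tau>) (k + m - 1) (k + m) (S_set k \<sigma>) \<longleftrightarrow>
      (\<exists>r\<in>{1..k}. k + m - 1 = bead k \<tau> r \<and> \<sigma> = \<tau>(r := \<tau> r + 1))"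
      using moves_bead_1_iff[OF \<tau> \<sigma>, of "k + m - 1"] by simp
    also have "\<dots> \<longleftrightarrow> 1 \<in> {1..k} \<and> k + m - 1 = bead k \<tau> 1 \<and> \<sigma> = \<tau>(1 := \<tau> 1 + 1)"
      using top by blast
    also have "k + m - 1 = bead k \<tau> 1 \<longleftrightarrow> m = \<tau> 1 + 1" by (auto simp: bead_def)
    finally show ?thesis unfolding adds_square_iff[OF \<tau> \<sigma>] by blast
  qed
  have "(\<exists>Q\<in>removable m. adds_squares k Q \<tau> \<sigma>) \<longleftrightarrow>
    ((\<exists>r c. red m (r, c) = True \<and> adds_squares k {(r, c), (r, c + 1)} \<tau> \<sigma>) \<or>
     (\<exists>r c. red m (r, c) = (\<not> True) \<and> adds_squares k {(r, c), (r + 1, c)} \<tau> \<sigma>)) \<or>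
    adds_squares k {(1, m)} \<tau> \<sigma>"
    unfolding removable_def bex_Un by (auto simp: red_iff_even)
  then show ?thesis unfolding corner adds_domino_iff_moves_bead[OF \<tau> \<sigma>] by simp
qed

lemma addable_iff_moves_bead:
  assumes \<sigma>: "\<sigma> \<in> partitions k m" and \<tau>: "\<tau> \<in> partitions k m"
  shows "(\<exists>Q\<in>addable m. adds_squares k Q \<sigma> \<tau>) \<longleftrightarrow>
    (\<exists>b. even (b + k + m) \<and> moves_bead (S_set k \<sigma>) b (b + 2) (S_set k \<tau>))"
proof -
  have "(\<exists>Q\<in>addable m. adds_squares k Q \<sigma> \<tau>) \<longleftrightarrow>
    ((\<exists>r c. red m (r, c) = False \<and> adds_squares k {(r, c), (r, c + 1)} \<sigma> \<tau>) \<or>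
     (\<exists>r c. red m (r, c) = (\<not> False) \<and> adds_squares k {(r, c), (r + 1, c)} \<sigma> \<tau>))"
    unfolding addable_def bex_Un by (auto simp: red_iff_even)
  then show ?thesis unfolding adds_domino_iff_moves_bead[OF \<sigma> \<tau>] by simp
qed

section \<open>The permutation and the colors\<close>

lemma perm_pi_bij: "bij_betw (perm_pi N) {1..N} {1..N}"
proof -
  have inj: "inj_on (perm_pi N) {1..N}"
    by (rule inj_onI) (auto simp: perm_pi_def split: if_splits; presburger)
  moreover have "perm_pi N ` {1..N} \<subseteq> {1..N}"
    by (auto simp: perm_pi_def)
  ultimately show ?thesis by (simp add: bij_betw_def endo_inj_surj)
qed

lemma x_color_eq_perm_pi: "x_color N i = perm_pi N i"
  by (simp add: x_color_def perm_pi_def)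

lemma y_color_eq_perm_pi: "y_color N i = perm_pi N (i + 1)"
  unfolding y_color_def perm_pi_def by (auto; presburger)

text \<open>The pairs \<open>(x_color N i, y_color N i)\<close> fall into three families: for \<open>i < N div 2\<close> the pairs
  \<open>(b, b + 2)\<close> with \<open>b\<close> of the parity of \<open>N - 1\<close>, for \<open>i = N div 2\<close> the pair \<open>(N - 1, N)\<close>, and for
  larger \<open>i\<close> the pairs \<open>(b + 2, b)\<close> with \<open>b\<close> of the parity of \<open>N\<close>.\<close>

lemma ex_color_iff:
  assumes "\<And>x y. M x y \<Longrightarrow> x \<in> {1..N} \<and> y \<in> {1..N}"
  shows "(\<exists>i\<in>{1..N - 1}. M (x_color N i) (y_color N i)) \<longleftrightarrow>
    (\<exists>b. odd (b + N) \<and> M b (b + 2)) \<or> M (N - 1) N \<or> (\<exists>b. even (b + N) \<and> M (b + 2) b)"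
    (is "?L \<longleftrightarrow> ?R")
proof
  assume ?L
  then obtain i where i: "i \<in> {1..N - 1}" "M (x_color N i) (y_color N i)" by blast
  consider "i < N div 2" | "i = N div 2" | "N div 2 < i" by linarith
  then show ?R
  proof cases
    case 1
    then have "odd (x_color N i + N)" "y_color N i = x_color N i + 2"
      by (auto simp: x_color_def y_color_def)
    with i show ?thesis by metis
  next
    case 2
    then have "x_color N i = N - 1" "y_color N i = N"
      by (auto simp: x_color_def y_color_def elim: oddE)
    with i show ?thesis by simp
  next
    case 3
    then have "even (y_color N i + N)" "x_color N i = y_color N i + 2"
      by (auto simp: x_color_def y_color_def)
    with i show ?thesis by metis
  qed
next
  assume ?R
  then consider b where "odd (b + N)" "M b (b + 2)" | "M (N - 1) N"
    | b where "even (b + N)" "M (b + 2) b" by blast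
  then show ?L
  proof cases
    case 1
    have "1 \<le> b" "b + 2 \<le> N" using assms[OF 1(2)] by auto
    then have "(b + 1) div 2 \<in> {1..N - 1}" "x_color N ((b + 1) div 2) = b"
      "y_color N ((b + 1) div 2) = b + 2"
      using 1(1) unfolding x_color_def y_color_def by (auto; presburger)+
    with 1(2) show ?thesis by metis
  next
    case 2
    have "2 \<le> N" using assms[OF 2] by auto
    then have "N div 2 \<in> {1..N - 1}" "x_color N (N div 2) = N - 1" "y_color N (N div 2) = N"
      unfolding x_color_def y_color_def by (auto; presburger)+
    with 2 show ?thesis by metis
  next
    case 3
    have "1 \<le> b" "b + 2 \<le> N" using assms[OF 3(2)] by auto
    then have "N - (b + 1) div 2 \<in> {1..N - 1}" "x_color N (N - (b + 1) div 2) = b + 2"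
      "y_color N (N - (b + 1) div 2) = b"
      using 3(1) unfolding x_color_def y_color_def by (auto; presburger)+
    with 3(2) show ?thesis by metis
  qed
qed

text \<open>A move adding a domino is read backwards here, as a bead of \<open>\<tau>\<close> going down by two, so that
  removals and additions are both moves from \<open>\<tau>\<close> to \<open>\<sigma>\<close>, as in the definition of the colors.\<close>

lemma domino_move_iff_moves_bead:
  assumes \<sigma>: "\<sigma> \<in> partitions k (N - k)" and \<tau>: "\<tau> \<in> partitions k (N - k)" and k: "1 \<le> k"
  shows "domino_move k (N - k) \<sigma> \<tau> \<longleftrightarrow>
    (\<exists>i\<in>{1..N - 1}. moves_bead (S_set k \<tau>) (x_color N i) (y_color N i) (S_set k \<sigma>))"
proof -
  let ?M = "\<lambda>x y. moves_bead (S_set k \<tau>) x y (S_set k \<sigma>)"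
  have "x \<in> {1..N} \<and> y \<in> {1..N}" if "?M x y" for x y
    using that S_set_subset[OF \<sigma>] S_set_subset[OF \<tau>] by (auto simp: moves_bead_def)
  from ex_color_iff[of ?M N, OF this] show ?thesis
    unfolding domino_move_iff_adds_squares removable_iff_moves_bead[OF \<tau> \<sigma> k]
      addable_iff_moves_bead[OF \<sigma> \<tau>] moves_bead_sym[of "S_set k \<sigma>"]
    by (auto simp: add.assoc)
qed

text \<open>The pair of positions attached to color \<open>i\<close> is the image of \<open>(i, i + 1)\<close> under \<open>perm_pi\<close>.\<close>

lemma has_color_D_part:
  "has_color (D_part k N) (\<sigma>, \<tau>) i \<longleftrightarrow>
     i \<in> {1..N - 1} \<and> moves_bead (S_set k \<tau>) (perm_pi N i) (perm_pi N (i + 1)) (S_set k \<sigma>)"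
  by (simp add: D_part_def moves_bead_def x_color_eq_perm_pi y_color_eq_perm_pi)

lemma edges_D_part:
  assumes "1 \<le> k"
  shows "edges (D_part k N) = {(\<sigma>, \<tau>). \<sigma> \<in> partitions k (N - k) \<and> \<tau> \<in> partitions k (N - k) \<and>
    (\<exists>i. has_color (D_part k N) (\<sigma>, \<tau>) i)}"
proof -
  have "domino_move k (N - k) \<sigma> \<tau> \<longleftrightarrow> (\<exists>i. has_color (D_part k N) (\<sigma>, \<tau>) i)"
    if "\<sigma> \<in> partitions k (N - k)" "\<tau> \<in> partitions k (N - k)" for \<sigma> \<tau>
    unfolding domino_move_iff_moves_bead[OF that assms] has_color_D_part
      x_color_eq_perm_pi y_color_eq_perm_pi by blast
  moreover have "edges (D_part k N) = {(\<sigma>, \<tau>). \<sigma> \<in> partitions k (N - k) \<and>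
      \<tau> \<in> partitions k (N - k) \<and> domino_move k (N - k) \<sigma> \<tau>}"
    by (simp add: D_part_def)
  ultimately show ?thesis by auto
qed

lemma moves_bead_T_set:
  "moves_bead (T_set k N \<tau>) x y (T_set k N \<sigma>) \<longleftrightarrow>
     moves_bead (S_set k \<tau>) (N + 1 - x) (N + 1 - y) (S_set k \<sigma>)"
  using moves_bead_image[of "\<lambda>s. N + 1 - s" UNIV "S_set k \<tau>" "S_set k \<sigma>" "N + 1 - x" "N + 1 - y"]
  by (simp add: T_set_eq_reflected_S_set inj_on_def)

lemma T_set_subset: "\<sigma> \<in> partitions k (N - k) \<Longrightarrow> T_set k N \<sigma> \<subseteq> {1..N}"
  using S_set_subset[of \<sigma> k "N - k"] by (auto simp: T_set_eq_reflected_S_set)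

text \<open>The bead of row \<open>l\<close> of \<open>\<sigma>\<close> is at position \<open>N - i\<close> when the edge has color \<open>i\<close>, and it moves up
  to \<open>N - i + 1\<close>. In the mirror image this is a move from \<open>i + 1\<close> to \<open>i\<close>; read from \<open>\<tau>\<close> to \<open>\<sigma>\<close>, it
  has the form of the Domino Game moves.\<close>

lemma has_color_L_part:
  assumes \<sigma>: "\<sigma> \<in> partitions k (N - k)" and \<tau>: "\<tau> \<in> partitions k (N - k)"
  shows "has_color (L_part k N) (\<sigma>, \<tau>) i \<longleftrightarrow>
     i \<in> {1..N - 1} \<and> moves_bead (T_set k N \<tau>) i (i + 1) (T_set k N \<sigma>)"
proof -
  have unit: "diff_is_unit k \<sigma> \<tau> l \<longleftrightarrow> \<tau> = \<sigma>(l := \<sigma> l + 1)" if l: "l \<in> {1..k}" for l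
  proof
    assume unit: "diff_is_unit k \<sigma> \<tau> l"
    show "\<tau> = \<sigma>(l := \<sigma> l + 1)"
    proof (intro partition_ext[OF \<tau>] extensional_fun_upd extensional_partition[OF \<sigma>] l)
      fix s assume "s \<in> {1..k}"
      then have "\<tau> s - \<sigma> s = (if s = l then 1 else 0)"
        using unit unfolding diff_is_unit_def by blast
      then show "\<tau> s = (\<sigma>(l := \<sigma> l + 1)) s" by (auto split: if_splits)
    qed
  qed (simp add: diff_is_unit_def)
  have "has_color (L_part k N) (\<sigma>, \<tau>) i \<longleftrightarrow>
    (\<exists>l\<in>{1..k}. N - i = bead k \<sigma> l \<and> \<tau> = \<sigma>(l := \<sigma> l + 1))"
    by (auto simp: L_part_def unit bead_def)
  also have "\<dots> \<longleftrightarrow> moves_bead (S_set k \<sigma>) (N - i) (N - i + 1) (S_set k \<tau>)"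
    unfolding moves_bead_1_iff[OF \<sigma> \<tau>] ..
  also have "\<dots> \<longleftrightarrow> moves_bead (T_set k N \<tau>) i (i + 1) (T_set k N \<sigma>)"
    unfolding moves_bead_T_set moves_bead_sym[of "S_set k \<sigma>"] by (simp add: algebra_simps)
  also have "\<dots> \<longleftrightarrow> i \<in> {1..N - 1} \<and> moves_bead (T_set k N \<tau>) i (i + 1) (T_set k N \<sigma>)"
    using T_set_subset[OF \<sigma>] T_set_subset[OF \<tau>] by (auto simp: moves_bead_def)
  finally show ?thesis .
qed

lemma edges_L_part:
  "edges (L_part k N) = {(\<sigma>, \<tau>). \<sigma> \<in> partitions k (N - k) \<and> \<tau> \<in> partitions k (N - k) \<and>
    (\<exists>i. has_color (L_part k N) (\<sigma>, \<tau>) i)}"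
  by (auto simp: L_part_def)

section \<open>The isomorphism\<close>

lemma edge_colored_digraphI:
  assumes "edges G = {(u, v). u \<in> vertices G \<and> v \<in> vertices G \<and> (\<exists>i. has_color G (u, v) i)}"
    and unique: "\<And>u v i j. u \<in> vertices G \<Longrightarrow> v \<in> vertices G \<Longrightarrow>
      has_color G (u, v) i \<Longrightarrow> has_color G (u, v) j \<Longrightarrow> i = j"
    and range: "\<And>u v i. u \<in> vertices G \<Longrightarrow> v \<in> vertices G \<Longrightarrow> has_color G (u, v) i \<Longrightarrow> i \<in> C"
  shows "edge_colored_digraph C G"
proof -
  have edge: "fst e \<in> vertices G \<and> snd e \<in> vertices G \<and> (\<exists>i. has_color G e i)" if "e \<in> edges G" for e
    using that unfolding assms(1) by auto
  have "pair_wf_digraph (digraph G)"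
    by unfold_locales (use edge in blast)+
  moreover have "(\<exists>!i. has_color G e i) \<and> (\<forall>i. has_color G e i \<longrightarrow> i \<in> C)" if "e \<in> edges G" for e
    using edge[OF that] unique[of "fst e" "snd e"] range[of "fst e" "snd e"]
    unfolding prod.collapse by blast
  ultimately show ?thesis by (simp add: edge_colored_digraph_def)
qed

text \<open>If the edges are exactly the pairs that carry a color, colors are all that has to be compared,
  and an equivalence of colors under \<open>f\<close> gives both directions of the isomorphism. It also transfers
  uniqueness and range of the colors from \<open>H\<close> to \<open>G\<close>.\<close>

lemma colored_digraph_isoI:
  assumes G: "edges G = {(u, v). u \<in> vertices G \<and> v \<in> vertices G \<and> (\<exists>i. has_color G (u, v) i)}"
    and H: "edges H = {(u, v). u \<in> vertices H \<and> v \<in> vertices H \<and> (\<exists>i. has_color H (u, v) i)}"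
    and unique: "\<And>u v i j. has_color H (u, v) i \<Longrightarrow> has_color H (u, v) j \<Longrightarrow> i = j"
    and range: "\<And>u v i. has_color H (u, v) i \<Longrightarrow> i \<in> C"
    and bij: "bij_betw f (vertices G) (vertices H)"
    and color: "\<And>u v i. u \<in> vertices G \<Longrightarrow> v \<in> vertices G \<Longrightarrow>
      has_color H (f u, f v) i \<longleftrightarrow> has_color G (u, v) i"
  shows "colored_digraph_iso C f G H"
proof -
  let ?g = "inv_into (vertices G) f"
  have f: "f u \<in> vertices H" if "u \<in> vertices G" for u using bij that by (rule bij_betwE[THEN bspec])
  have g: "?g v \<in> vertices G" "f (?g v) = v" if "v \<in> vertices H" for v
    using bij that by (auto simp: bij_betw_def inv_into_into f_inv_into_f)
  have colorg: "has_color G (?g u, ?g v) i \<longleftrightarrow> has_color H (u, v) i"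
    if "u \<in> vertices H" "v \<in> vertices H" for u v i
    using color[of "?g u" "?g v" i] g that by simp
  have "edge_colored_digraph C G"
    by (rule edge_colored_digraphI[OF G]) (use color unique range in blast)+
  moreover have "edge_colored_digraph C H"
    by (rule edge_colored_digraphI[OF H]) (use unique range in blast)+
  moreover have "preserves_colored_edges f G H"
    unfolding preserves_colored_edges_def G H using color f by auto
  moreover have "preserves_colored_edges ?g H G"
    unfolding preserves_colored_edges_def G H using colorg g by auto
  ultimately show ?thesis using bij by (simp add: colored_digraph_iso_def)
qed

lemma Phi_eq_partition_of: "Phi k N \<sigma> = partition_of k (perm_pi N ` T_set k N \<sigma>)"
  by (simp add: Phi_def partition_of_def)

lemma card_T_set:
  assumes "\<sigma> \<in> partitions k (N - k)" "0 \<le> k"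
  shows "int (card (T_set k N \<sigma>)) = k"
  using card_S_set[OF assms] by (simp add: T_set_eq_reflected_S_set card_image inj_on_def)

lemma
  assumes \<sigma>: "\<sigma> \<in> partitions k (N - k)" and k: "0 \<le> k"
  shows Phi_in_partitions: "Phi k N \<sigma> \<in> partitions k (N - k)"
    and S_set_Phi: "S_set k (Phi k N \<sigma>) = perm_pi N ` T_set k N \<sigma>"
proof -
  have "inj_on (perm_pi N) (T_set k N \<sigma>)"
    using perm_pi_bij T_set_subset[OF \<sigma>] by (metis bij_betw_imp_inj_on inj_on_subset)
  then have card: "int (card (perm_pi N ` T_set k N \<sigma>)) = k"
    using card_T_set[OF \<sigma> k] by (simp only: card_image)
  have subset: "perm_pi N ` T_set k N \<sigma> \<subseteq> {1..k + (N - k)}"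
    using image_mono[OF T_set_subset[OF \<sigma>], of "perm_pi N"] perm_pi_bij[of N]
    by (simp add: bij_betw_def)
  show "Phi k N \<sigma> \<in> partitions k (N - k)"
    "S_set k (Phi k N \<sigma>) = perm_pi N ` T_set k N \<sigma>"
    unfolding Phi_eq_partition_of by (fact S_set_partition_of[OF subset card])+
qed

text \<open>\<open>Phi_inv\<close> lists a set in increasing order where \<open>partition_of\<close> lists one in decreasing order;
  reflecting the set with \<open>t \<mapsto> N + 1 - t\<close> turns one listing into the other.\<close>

lemma
  assumes \<tau>: "\<tau> \<in> partitions k (N - k)" and k: "0 \<le> k"
  shows Phi_inv_in_partitions: "Phi_inv k N \<tau> \<in> partitions k (N - k)"
    and T_set_Phi_inv: "T_set k N (Phi_inv k N \<tau>) = inv_into {1..N} (perm_pi N) ` S_set k \<tau>"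
proof -
  let ?T = "inv_into {1..N} (perm_pi N) ` S_set k \<tau>"
  let ?A = "(\<lambda>t. N + 1 - t) ` ?T"
  have S: "S_set k \<tau> \<subseteq> {1..N}" using S_set_subset[OF \<tau>] by simp
  note inv = bij_betw_inv_into[OF perm_pi_bij, of N]
  have T: "?T \<subseteq> {1..N}" using image_mono[OF S] inv by (metis bij_betw_def)
  have "inj_on (inv_into {1..N} (perm_pi N)) (S_set k \<tau>)"
    using inv S by (metis bij_betw_imp_inj_on inj_on_subset)
  then have cT: "int (card ?T) = k" using card_S_set[OF \<tau> k] by (simp only: card_image)
  have "inj_on (\<lambda>t. N + 1 - t) ?T" by (simp add: inj_on_def)
  then have cA: "int (card ?A) = k" using cT by (simp only: card_image)
  have A: "?A \<subseteq> {1..k + (N - k)}" using T by auto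
  have T_eq: "(\<lambda>s. N + 1 - s) ` ?A = ?T" by (simp add: image_image)
  have "Phi_inv k N \<tau> = partition_of k ?A"
  proof
    fix j
    have "finite ?A" using A by (rule finite_subset) simp
    then have "nth_increasing ?T j = N + 1 - nth_decreasing ?A j" if "j \<in> {1..k}"
      using nth_increasing_reflect[of ?A j "N + 1"] that unfolding T_eq cA by blast
    then show "Phi_inv k N \<tau> j = partition_of k ?A j"
      by (cases "j \<in> {1..k}")
        (simp_all only: Phi_inv_def partition_of_def restrict_apply if_True if_False)
  qed
  then show "Phi_inv k N \<tau> \<in> partitions k (N - k)" "T_set k N (Phi_inv k N \<tau>) = ?T"
    by (simp_all only: T_set_eq_reflected_S_set S_set_partition_of[OF A cA] T_eq)
qed

lemma Phi_Phi_inv: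
  assumes \<tau>: "\<tau> \<in> partitions k (N - k)" and k: "0 \<le> k"
  shows "Phi k N (Phi_inv k N \<tau>) = \<tau>"
proof -
  have "S_set k \<tau> \<subseteq> perm_pi N ` {1..N}"
    using S_set_subset[OF \<tau>] perm_pi_bij[of N] by (simp add: bij_betw_def)
  then have "perm_pi N ` T_set k N (Phi_inv k N \<tau>) = S_set k \<tau>"
    unfolding T_set_Phi_inv[OF \<tau> k] by (rule image_inv_into_cancel[OF refl])
  then show ?thesis using partition_of_S_set[OF \<tau>] by (simp add: Phi_eq_partition_of)
qed

lemma inj_on_Phi:
  assumes k: "0 \<le> k"
  shows "inj_on (Phi k N) (partitions k (N - k))"
proof (rule inj_onI)
  fix \<sigma> \<tau>
  assume \<sigma>: "\<sigma> \<in> partitions k (N - k)" and \<tau>: "\<tau> \<in> partitions k (N - k)"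
    and "Phi k N \<sigma> = Phi k N \<tau>"
  then have "perm_pi N ` T_set k N \<sigma> = perm_pi N ` T_set k N \<tau>"
    using S_set_Phi k by metis
  then have "T_set k N \<sigma> = T_set k N \<tau>"
    using inj_on_image_eq_iff[OF bij_betw_imp_inj_on[OF perm_pi_bij] T_set_subset[OF \<sigma>] T_set_subset[OF \<tau>]]
    by simp
  then have "S_set k \<sigma> = S_set k \<tau>"
    unfolding T_set_eq_reflected_S_set by (simp add: inj_image_eq_iff inj_on_def)
  then show "\<sigma> = \<tau>" using \<sigma> \<tau> by (metis inj_on_S_set inj_onD)
qed

lemma has_color_Phi:
  assumes \<sigma>: "\<sigma> \<in> partitions k (N - k)" and \<tau>: "\<tau> \<in> partitions k (N - k)" and k: "0 \<le> k"
  shows "has_color (D_part k N) (Phi k N \<sigma>, Phi k N \<tau>) i \<longleftrightarrow> has_color (L_part k N) (\<sigma>, \<tau>) i"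
  unfolding has_color_D_part has_color_L_part[OF \<sigma> \<tau>] S_set_Phi[OF \<sigma> k] S_set_Phi[OF \<tau> k]
  using moves_bead_image[OF bij_betw_imp_inj_on[OF perm_pi_bij] T_set_subset[OF \<tau>] T_set_subset[OF \<sigma>],
      of i "i + 1"]
  by auto

theorem theorem5p9:
  fixes k N :: int
  assumes "1 \<le> k" and "k \<le> N - 1"
  shows "colored_digraph_iso {1..N - 1} (Phi k N) (L_part k N) (D_part k N) \<and>
    (\<forall>\<tau> \<in> vertices (D_part k N).
       inv_into (vertices (L_part k N)) (Phi k N) \<tau> = Phi_inv k N \<tau>)"
proof
  have k: "0 \<le> k" using assms(1) by simp
  have V: "vertices (L_part k N) = partitions k (N - k)" "vertices (D_part k N) = partitions k (N - k)"
    by (simp_all add: L_part_def D_part_def)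
  have bij: "bij_betw (Phi k N) (partitions k (N - k)) (partitions k (N - k))"
    unfolding bij_betw_def
    using inj_on_Phi[OF k] Phi_in_partitions[OF _ k] Phi_inv_in_partitions[OF _ k] Phi_Phi_inv[OF _ k]
    by (metis image_subsetI imageI subsetI subset_antisym)
  show "colored_digraph_iso {1..N - 1} (Phi k N) (L_part k N) (D_part k N)"
  proof (rule colored_digraph_isoI)
    fix \<sigma> \<tau> i j
    assume "has_color (D_part k N) (\<sigma>, \<tau>) i" "has_color (D_part k N) (\<sigma>, \<tau>) j"
    then have "perm_pi N i = perm_pi N j" "i \<in> {1..N}" "j \<in> {1..N}"
      by (auto simp: has_color_D_part dest: moves_bead_unique)
    then show "i = j" using bij_betw_imp_inj_on[OF perm_pi_bij] by (metis inj_onD)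
  next
    fix \<sigma> \<tau> i
    assume "\<sigma> \<in> vertices (L_part k N)" "\<tau> \<in> vertices (L_part k N)"
    then show "has_color (D_part k N) (Phi k N \<sigma>, Phi k N \<tau>) i \<longleftrightarrow> has_color (L_part k N) (\<sigma>, \<tau>) i"
      unfolding V by (rule has_color_Phi[OF _ _ k])
  qed (simp_all add: V edges_L_part edges_D_part[OF assms(1)] bij has_color_D_part)
  show "\<forall>\<tau> \<in> vertices (D_part k N). inv_into (vertices (L_part k N)) (Phi k N) \<tau> = Phi_inv k N \<tau>"
    unfolding V using inj_on_Phi[OF k] Phi_inv_in_partitions[OF _ k] Phi_Phi_inv[OF _ k]
    by (metis inv_into_f_eq)
qed

end
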